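(* Let $\beta,\lambda\in\mathbb{C}$. For every integer $m\ge 2$ the polynomials $s^{(1)}_m$ and $s^{(-)}_m$ defined in the context satisfy $$\begin{aligned}s^{(1)}_m(y)&=(\lambda-\beta+2m)\,s^{(-)}_{m}(y)-2m(\lambda+2m)(\lambda-\tfrac{\beta}{2}+m)\,s^{(-)}_{m-1}(y)\\&\quad+m(m-1)(\lambda+\beta+2m)(\lambda-\tfrac{\beta}{2}+m-1)_2\,s^{(-)}_{m-2}(y)-(\lambda)_m(\lambda-\beta)(\tfrac{\beta}{2})_m\,s^{(-)}_0(y),\end{aligned}$$ where $s^{(-)}_0(y)=1$.
   Context: Pochhammer symbol: $(a)_0=1$, $(a)_m=a(a+1)\cdots(a+m-1)$ for $m\ge1$, and $(a)_{-1}=\frac{1}{a-1}$ (in general $(a)_m=\Gamma(a+m)/\Gamma(a)$). For $k\in\mathbb{N}_0$ and $\alpha\in\mathbb{R}$ put $R_k(y;\alpha):=\prod_{l=1}^k\big[y-(\alpha-l)(\alpha-l+1)\big]$, $R_0(y;\alpha)=1$; in particular $R_k(y;0)=\prod_{l=1}^k[y-l(l-1)]$. For $m\in\mathbb{N}_0$ define $$s^{(-)}_m(y):=\sum_{k=0}^{m}\binom{m}{k}(\tfrac{\beta}{2}-\lambda-m)_{m-k}(-\tfrac{\beta}{2}-m-1)_{m-k}\,R_k(y;0).$$ For $k\ge 1$ define $$R^{(1)}_k(y):=\sum_{j=1}^k(\tfrac{\beta}{2}-k+j+1)_{2(k-j)}\big[y-\tfrac{\beta}{2}(\tfrac{\beta}{2}+1)\big]R_{j-1}(y;k),\qquad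 R^{(1)}_0(y):=0,$$ and $$s^{(1)}_m(y):=\sum_{k=0}^{m}D^{(1)}_k(m)\,R^{(1)}_k(y),$$ $$D^{(1)}_k(m):=\binom{m}{k}(\lambda-\tfrac{\beta}{2}+k+1)_{m-k}(\tfrac{\beta}{2}+k+1)_{m-k-1}\big[k(\lambda+\beta+2m)+\tfrac{\beta}{2}(\lambda-\beta-2m)\big].$$ For $k=m$ the factor $(\tfrac{\beta}{2}+m+1)_{-1}=\frac{1}{\beta/2+m}$ cancels and $D^{(1)}_m(m)=\lambda-\beta+2m$; this value is used also when $\tfrac{\beta}{2}=-m$. *)

theory Defs
  imports Complex_Main "HOL-Computational_Algebra.Polynomial"
begin

text \<open>
  The symbol \<open>(a)\<^sub>m\<close> for integer \<open>m\<close>, with \<open>(a)\<^sub>m = \<Gamma>(a + m) / \<Gamma>(a)\<close>; for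
  \<open>m = - n < 0\<close> this is \<open>1 / ((a - n) \<dots> (a - 1))\<close>. It is needed only where the index
  can be \<open>-1\<close>; elsewhere the library's \<^const>\<open>pochhammer\<close> is used.
\<close>

definition poch_int :: "complex \<Rightarrow> int \<Rightarrow> complex" where
  "poch_int a m =
     (if m \<ge> 0 then pochhammer a (nat m)
      else 1 / pochhammer (a + of_int m) (nat (- m)))"

lemma poch_int_of_nat: "poch_int a (int n) = pochhammer a n"
  by (simp add: poch_int_def)

lemma poch_int_minus_one: "poch_int a (- 1) = 1 / (a - 1)"
  by (simp add: poch_int_def)

definition R_poly :: "nat \<Rightarrow> real \<Rightarrow> complex poly" where
  "R_poly k \<alpha> =
     (\<Prod>l=1..k. [:0, 1:] - [: of_real ((\<alpha> - real l) * (\<alpha> - real l + 1)) :])"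

definition s_minus :: "complex \<Rightarrow> complex \<Rightarrow> nat \<Rightarrow> complex poly" where
  "s_minus \<beta> lam m =
     (\<Sum>k=0..m. smult
        (of_nat (m choose k) * pochhammer (\<beta> / 2 - lam - of_nat m) (m - k)
           * pochhammer (- \<beta> / 2 - of_nat m - 1) (m - k))
        (R_poly k 0))"

definition R_one :: "complex \<Rightarrow> nat \<Rightarrow> complex poly" where
  "R_one \<beta> k =
     (\<Sum>j=1..k. smult
        (pochhammer (\<beta> / 2 - of_nat k + of_nat j + 1) (2 * (k - j)))
        (([:0, 1:] - [: \<beta> / 2 * (\<beta> / 2 + 1) :]) * R_poly (j - 1) (real k)))"

text \<open>
  For \<open>k = m\<close> the index \<open>m - k - 1\<close> is \<open>-1\<close>, and the factor \<open>1 / (\<beta>/2 + m)\<close> cancels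
  against the bracket. At \<open>\<beta>/2 = - m\<close>, where the quotient would be \<open>0 / 0\<close>, the value
  after cancellation is used.
\<close>

definition D_one :: "complex \<Rightarrow> complex \<Rightarrow> nat \<Rightarrow> nat \<Rightarrow> complex" where
  "D_one \<beta> lam m k =
     (if k = m \<and> \<beta> / 2 = - of_nat m then lam - \<beta> + 2 * of_nat m
      else of_nat (m choose k)
             * pochhammer (lam - \<beta> / 2 + of_nat k + 1) (m - k)
             * poch_int (\<beta> / 2 + of_nat k + 1) (int m - int k - 1)
             * (of_nat k * (lam + \<beta> + 2 * of_nat m)
                  + \<beta> / 2 * (lam - \<beta> - 2 * of_nat m)))"

lemma D_one_diag: "D_one \<beta> lam m m = lam - \<beta> + 2 * of_nat m"
proof (cases "\<beta> / 2 = - of_nat m")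
  case True
  then show ?thesis by (simp add: D_one_def)
next
  case False
  then have nz: "\<beta> / 2 + of_nat m \<noteq> 0"
    by (simp add: eq_neg_iff_add_eq_0)
  have "of_nat m * (lam + \<beta> + 2 * of_nat m) + \<beta> / 2 * (lam - \<beta> - 2 * of_nat m)
          = (\<beta> / 2 + of_nat m) * (lam - \<beta> + 2 * of_nat m)"
    by (simp add: field_simps)
  with nz False show ?thesis
    by (simp add: D_one_def poch_int_minus_one)
qed

definition s_one :: "complex \<Rightarrow> complex \<Rightarrow> nat \<Rightarrow> complex poly" where
  "s_one \<beta> lam m = (\<Sum>k=0..m. smult (D_one \<beta> lam m k) (R_one \<beta> k))"

end

theory Submission
  imports Defs
begin

text \<open>
  Put \<open>b = \<beta>/2\<close>, \<open>B = b (b + 1)\<close> and \<open>c\<^sub>t = t (t - 1)\<close>, so that \<open>R\<^sub>k(y;0)\<close> is the product of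
  \<open>y - c\<^sub>1, \<dots>, y - c\<^sub>k\<close>. Three observations give the identity.

  The sum defining \<open>R\<^sup>(\<^sup>1\<^sup>)\<^sub>k\<close> telescopes. Its Pochhammer factors are products of the numbers
  \<open>B - c\<^sub>t\<close> with small \<open>t\<close>, its factors \<open>R\<^sub>j\<^sub>-\<^sub>1(y;k)\<close> are products of the \<open>y - c\<^sub>t\<close> with large
  \<open>t\<close>, and \<open>y - B\<close> is the difference of \<open>y - c\<^sub>t\<close> and \<open>B - c\<^sub>t\<close> for the one index in between.
  Hence \<open>R\<^sup>(\<^sup>1\<^sup>)\<^sub>k(y) = R\<^sub>k(y;0) - R\<^sub>k(B;0)\<close> (lemma \<open>R_one_eq\<close>).

  Therefore \<open>s\<^sup>(\<^sup>1\<^sup>)\<^sub>m\<close> is, up to a constant, the combination of the \<open>R\<^sub>k(y;0)\<close> with coefficients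
  \<open>D\<^sup>(\<^sup>1\<^sup>)\<^sub>k(m)\<close>. These are the stated combination of the coefficients of \<open>s\<^sup>(\<^sup>-\<^sup>)\<^sub>m\<close>,
  \<open>s\<^sup>(\<^sup>-\<^sup>)\<^sub>m\<^sub>-\<^sub>1\<close> and \<open>s\<^sup>(\<^sup>-\<^sup>)\<^sub>m\<^sub>-\<^sub>2\<close>: after a common hypergeometric factor is removed, this is an
  identity between polynomials in \<open>b\<close>, \<open>\<lambda>\<close>, \<open>k\<close> and \<open>m\<close> (lemma \<open>D_one_eq_combination\<close>).

  The constant left over is the sum of the \<open>D\<^sup>(\<^sup>1\<^sup>)\<^sub>k(m) R\<^sub>k(B;0)\<close>. Since \<open>R\<^sub>k(B;0)\<close> is
  \<open>(-1)\<^sup>k (b + 1)\<^sub>k (- b)\<^sub>k\<close>, the factor \<open>(b + 1)\<^sub>k\<close> completes the factor \<open>(b + k + 1)\<^sub>m\<^sub>-\<^sub>k\<^sub>-\<^sub>1\<close>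
  of \<open>D\<^sup>(\<^sup>1\<^sup>)\<^sub>k(m)\<close> to \<open>(b + 1)\<^sub>m\<^sub>-\<^sub>1\<close>, which does not depend on \<open>k\<close>. What remains is a
  Chu-Vandermonde sum with a weight linear in \<open>k\<close>, and it has a closed form
  (lemma \<open>sum_D_one_constants\<close>).
\<close>

section \<open>Telescoping of the polynomials $R^{(1)}_k$\<close>

text \<open>
  Write \<open>x - b\<close> in the \<open>r\<close>-th summand as \<open>(x - c\<^sub>r\<^sub>+\<^sub>1) - (b - c\<^sub>r\<^sub>+\<^sub>1)\<close>. The index \<open>r + 1\<close> is the one
  missing from the two products, so consecutive summands cancel.
\<close>

lemma telescoping_prod_diff:
  fixes x b :: "'a::comm_ring_1" and c :: "nat \<Rightarrow> 'a"
  shows "(\<Sum>r<k. (\<Prod>t=1..r. b - c t) * ((x - b) * (\<Prod>t=r+2..k. x - c t)))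
           = (\<Prod>t=1..k. x - c t) - (\<Prod>t=1..k. b - c t)"
proof (induction k)
  case 0
  show ?case by simp
next
  case (Suc k)
  have split_last: "(\<Prod>t=r+2..Suc k. x - c t) = (\<Prod>t=r+2..k. x - c t) * (x - c (Suc k))"
    if "r < k" for r
    using that by (simp add: prod.cl_ivl_Suc)
  have "(\<Sum>r<Suc k. (\<Prod>t=1..r. b - c t) * ((x - b) * (\<Prod>t=r+2..Suc k. x - c t)))
      = (\<Sum>r<k. (\<Prod>t=1..r. b - c t) * ((x - b) * (\<Prod>t=r+2..k. x - c t))) * (x - c (Suc k))
        + (\<Prod>t=1..k. b - c t) * (x - b)"
    unfolding sum.lessThan_Suc sum_distrib_right
    by (intro arg_cong2[where f = "(+)"] sum.cong) (simp_all add: split_last mult.assoc)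
  then show ?case
    unfolding Suc.IH by (simp add: algebra_simps)
qed

text \<open>
  The factors \<open>b - r + 1, \<dots>, b + r\<close> pair off from the middle outwards as
  \<open>(b - t + 1) (b + t) = b (b + 1) - t (t - 1)\<close>. Thus the Pochhammer symbols in \<open>R\<^sup>(\<^sup>1\<^sup>)\<^sub>k\<close> are
  values of the polynomials \<open>R\<^sub>r(y;0)\<close> at \<open>y = b (b + 1)\<close>.
\<close>

lemma pochhammer_centred:
  fixes b :: "'a::field_char_0"
  shows "pochhammer (b - of_nat r + 1) (2 * r)
           = (\<Prod>t=1..r. b * (b + 1) - of_nat t * (of_nat t - 1))"
proof (induction r)
  case 0
  show ?case by simp
next
  case (Suc r)
  have "pochhammer (b - of_nat (Suc r) + 1) (2 * Suc r)
      = (b - of_nat r) * pochhammer (b - of_nat r + 1) (Suc (2 * r))"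
    using pochhammer_rec[of "b - of_nat r" "Suc (2 * r)"] by simp
  also have "\<dots> = (b - of_nat r) * (b + of_nat r + 1) * pochhammer (b - of_nat r + 1) (2 * r)"
    by (simp add: pochhammer_Suc algebra_simps)
  finally show ?case
    unfolding Suc.IH by (simp add: algebra_simps)
qed

text \<open>
  The same pairs \<open>(b + t) (b - t + 1)\<close>, now separated into an ascending and a descending half.
  The descending half, with all signs changed, is \<open>(- b)\<^sub>k\<close>.
\<close>

lemma pochhammer_prod_eq:
  fixes b :: "'a::comm_ring_1"
  shows "(\<Prod>t=1..k. b * (b + 1) - of_nat t * (of_nat t - 1))
           = (- 1) ^ k * pochhammer (b + 1) k * pochhammer (- b) k"
  by (induction k) (simp_all add: pochhammer_Suc algebra_simps)

lemma R_poly_zero: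
  "R_poly k 0 = (\<Prod>t=1..k. [:0, 1:] - [:of_nat t * (of_nat t - 1):])"
  unfolding R_poly_def by (intro prod.cong) (simp_all add: algebra_simps)

text \<open>
  The roots of \<open>R\<^sub>j(y;k)\<close> are \<open>c\<^sub>k, c\<^sub>k\<^sub>-\<^sub>1, \<dots>\<close>, where \<open>c\<^sub>t = t (t - 1)\<close>: the roots of \<open>R\<^sub>k(y;0)\<close>
  taken from the top. The substitution is \<open>t = k + 1 - l\<close>.
\<close>

lemma R_poly_shifted:
  assumes "r < k"
  shows "R_poly (k - r - 1) (real k) = (\<Prod>t=r+2..k. [:0, 1:] - [:of_nat t * (of_nat t - 1):])"
  unfolding R_poly_def
proof (rule prod.reindex_bij_witness[where i = "\<lambda>t. k + 1 - t" and j = "\<lambda>l. k + 1 - l"])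
  fix l assume "l \<in> {1..k - r - 1}"
  then have "l \<le> k" by auto
  then show "[:0, 1:] - [:of_nat (k + 1 - l) * (of_nat (k + 1 - l) - 1) :: complex:]
      = [:0, 1:] - [:of_real ((real k - real l) * (real k - real l + 1)):]"
    by (simp add: of_nat_diff Suc_diff_le algebra_simps)
qed (use assms in auto)

text \<open>
  With \<open>r = k - j\<close> the defining sum becomes the telescoping sum over constant and linear
  polynomials. The constant subtracted is \<open>R\<^sub>k(b (b + 1); 0)\<close> for \<open>b = \<beta>/2\<close>.
\<close>

lemma R_one_eq:
  fixes \<beta> :: complex
  shows "R_one \<beta> k = R_poly k 0 - [:(- 1) ^ k * pochhammer (\<beta> / 2 + 1) k * pochhammer (- \<beta> / 2) k:]"
proof -
  define b where "b = \<beta> / 2"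
  define c where "c t = of_nat t * (of_nat t - 1 :: complex)" for t :: nat
  have "R_one \<beta> k = (\<Sum>r<k. (\<Prod>t=1..r. [:b * (b + 1):] - [:c t:])
           * (([:0, 1:] - [:b * (b + 1):]) * (\<Prod>t=r+2..k. [:0, 1:] - [:c t:])))"
    unfolding R_one_def
  proof (rule sum.reindex_bij_witness[where i = "\<lambda>r. k - r" and j = "\<lambda>j. k - j"])
    fix j assume j: "j \<in> {1..k}"
    then have "R_poly (j - 1) (real k) = (\<Prod>t=k-j+2..k. [:0, 1:] - [:c t:])"
      using R_poly_shifted[of "k - j" k] by (simp add: c_def)
    moreover have "pochhammer (\<beta> / 2 - of_nat k + of_nat j + 1) (2 * (k - j))
        = (\<Prod>t=1..k-j. b * (b + 1) - c t)"
      using pochhammer_centred[of b "k - j"] j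
      by (simp add: b_def c_def of_nat_diff algebra_simps)
    ultimately show "(\<Prod>t=1..k-j. [:b * (b + 1):] - [:c t:])
           * (([:0, 1:] - [:b * (b + 1):]) * (\<Prod>t=k-j+2..k. [:0, 1:] - [:c t:]))
        = smult (pochhammer (\<beta> / 2 - of_nat k + of_nat j + 1) (2 * (k - j)))
            (([:0, 1:] - [:\<beta> / 2 * (\<beta> / 2 + 1):]) * R_poly (j - 1) (real k))"
      by (simp add: b_def prod_to_poly)
  qed auto
  also have "\<dots> = R_poly k 0 - [:\<Prod>t=1..k. b * (b + 1) - c t:]"
    unfolding telescoping_prod_diff by (simp add: R_poly_zero c_def prod_to_poly)
  finally show ?thesis
    using pochhammer_prod_eq[of b k] by (simp add: b_def c_def)
qed

section \<open>Two forms of the Chu-Vandermonde sum\<close>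

text \<open>
  This is the Vandermonde identity for \<open>(a + d)\<^sub>m\<close> with \<open>d = 1 - c - m\<close>: reversing the order of
  the factors turns \<open>(c + k)\<^sub>m\<^sub>-\<^sub>k\<close> into \<open>(-1)\<^sup>m\<^sup>-\<^sup>k (d)\<^sub>m\<^sub>-\<^sub>k\<close>, and
  \<open>(a + d)\<^sub>m\<close> into \<open>(-1)\<^sup>m (c - a)\<^sub>m\<close>.
\<close>

lemma Chu_Vandermonde_alternating:
  fixes a c :: "'a::field_char_0"
  shows "(\<Sum>k\<le>m. of_nat (m choose k) * (- 1) ^ k * pochhammer a k * pochhammer (c + of_nat k) (m - k))
           = pochhammer (c - a) m"
proof -
  have reflect: "(- 1) ^ k * pochhammer (c + of_nat k) (m - k)
      = (- 1) ^ m * pochhammer (1 - c - of_nat m) (m - k)" if "k \<le> m" for k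
  proof -
    have "pochhammer (1 - c - of_nat m) (m - k) = (- 1) ^ (m - k) * pochhammer (c + of_nat k) (m - k)"
      using pochhammer_minus[of "c + of_nat m - 1" "m - k"] that
      by (simp add: of_nat_diff algebra_simps)
    moreover have "(- 1 :: 'a) ^ m * (- 1) ^ (m - k) = (- 1) ^ k"
      using that by (metis (no_types, lifting) le_add_diff_inverse minus_one_mult_self mult.assoc mult.right_neutral power_add)
    ultimately show ?thesis by (metis mult.assoc)
  qed
  have "(\<Sum>k\<le>m. of_nat (m choose k) * (- 1) ^ k * pochhammer a k * pochhammer (c + of_nat k) (m - k))
      = (- 1) ^ m * (\<Sum>k\<le>m. of_nat (m choose k) * pochhammer a k * pochhammer (1 - c - of_nat m) (m - k))"
    unfolding sum_distrib_left
  proof (rule sum.cong[OF refl])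
    fix k assume "k \<in> {..m}"
    then show "of_nat (m choose k) * (- 1) ^ k * pochhammer a k * pochhammer (c + of_nat k) (m - k)
        = (- 1) ^ m * (of_nat (m choose k) * pochhammer a k * pochhammer (1 - c - of_nat m) (m - k))"
      using reflect[of k] by (simp add: algebra_simps)
  qed
  also have "\<dots> = (- 1) ^ m * pochhammer (a + (1 - c - of_nat m)) m"
    by (simp only: pochhammer_binomial_sum)
  also have "\<dots> = pochhammer (c - a) m"
    using pochhammer_minus'[of "c - a" m] pochhammer_minus[of "c - a + of_nat m - 1" m]
    by (simp add: algebra_simps)
  finally show ?thesis .
qed

text \<open>
  The weight \<open>k\<close> is absorbed into the binomial coefficient, which reduces the sum to the unweighted
  one for \<open>m - 1\<close>, \<open>a + 1\<close>, \<open>c + 1\<close>.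
\<close>

lemma Chu_Vandermonde_alternating_weighted:
  fixes a c :: "'a::field_char_0"
  assumes "m > 0"
  shows "(\<Sum>k\<le>m. of_nat k * (of_nat (m choose k) * (- 1) ^ k * pochhammer a k * pochhammer (c + of_nat k) (m - k)))
           = - of_nat m * a * pochhammer (c - a) (m - 1)"
proof -
  obtain n where m: "m = Suc n" using assms gr0_conv_Suc by blast
  have absorb: "of_nat (Suc k) * (of_nat (Suc n choose Suc k) :: 'a) = of_nat (Suc n) * of_nat (n choose k)" for k
    by (metis Suc_times_binomial_eq mult.commute of_nat_mult)
  have term_eq: "of_nat (Suc k) * (of_nat (Suc n choose Suc k) * (- 1) ^ Suc k * pochhammer a (Suc k)
          * pochhammer (c + of_nat (Suc k)) (Suc n - Suc k))
      = - of_nat (Suc n) * a * (of_nat (n choose k) * (- 1) ^ k * pochhammer (a + 1) k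
          * pochhammer (c + 1 + of_nat k) (n - k))" for k
  proof -
    have "of_nat (Suc k) * (of_nat (Suc n choose Suc k) * (- 1) ^ Suc k * pochhammer a (Suc k)
          * pochhammer (c + of_nat (Suc k)) (Suc n - Suc k))
      = (of_nat (Suc k) * of_nat (Suc n choose Suc k)) * ((- 1) ^ Suc k * pochhammer a (Suc k)
          * pochhammer (c + of_nat (Suc k)) (Suc n - Suc k))"
      by (simp only: mult.assoc)
    also have "\<dots> = - of_nat (Suc n) * a * (of_nat (n choose k) * (- 1) ^ k * pochhammer (a + 1) k
          * pochhammer (c + 1 + of_nat k) (n - k))"
      unfolding absorb pochhammer_rec by (simp add: ac_simps del: of_nat_Suc) (simp add: ac_simps)
    finally show ?thesis .
  qed
  show ?thesis
    unfolding m sum.atMost_Suc_shift term_eq sum_distrib_left[symmetric]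
      Chu_Vandermonde_alternating by simp
qed

section \<open>The coefficients $D^{(1)}_k(m)$\<close>

text \<open>
  The coefficient of \<open>R\<^sub>k(y;0)\<close> in \<open>s\<^sup>(\<^sup>-\<^sup>)\<^sub>m\<close>, with both Pochhammer symbols reversed so that their
  bases depend on \<open>k\<close> only. For neighbouring values of \<open>m\<close> they then differ by single factors.
\<close>

definition s_minus_coeff :: "complex \<Rightarrow> complex \<Rightarrow> nat \<Rightarrow> nat \<Rightarrow> complex" where
  "s_minus_coeff \<beta> lam m k = of_nat (m choose k)
     * pochhammer (lam - \<beta> / 2 + of_nat k + 1) (m - k) * pochhammer (\<beta> / 2 + of_nat k + 2) (m - k)"

text \<open>
  The range of summation may exceed \<open>m\<close>, because the binomial coefficient vanishes there. This lets
  \<open>s\<^sup>(\<^sup>-\<^sup>)\<^sub>m\<close>, \<open>s\<^sup>(\<^sup>-\<^sup>)\<^sub>m\<^sub>-\<^sub>1\<close> and \<open>s\<^sup>(\<^sup>-\<^sup>)\<^sub>m\<^sub>-\<^sub>2\<close> be added term by term.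
\<close>

lemma s_minus_eq:
  assumes "m \<le> n"
  shows "s_minus \<beta> lam m = (\<Sum>k=0..n. smult (s_minus_coeff \<beta> lam m k) (R_poly k 0))"
proof -
  have coeff: "of_nat (m choose k) * pochhammer (\<beta> / 2 - lam - of_nat m) (m - k)
           * pochhammer (- \<beta> / 2 - of_nat m - 1) (m - k) = s_minus_coeff \<beta> lam m k"
    if "k \<le> m" for k
  proof -
    have "pochhammer (\<beta> / 2 - lam - of_nat m) (m - k)
        = (- 1) ^ (m - k) * pochhammer (lam - \<beta> / 2 + of_nat k + 1) (m - k)"
      using pochhammer_minus[of "lam - \<beta> / 2 + of_nat m" "m - k"] that
      by (simp add: of_nat_diff algebra_simps)
    moreover have "pochhammer (- \<beta> / 2 - of_nat m - 1) (m - k)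
        = (- 1) ^ (m - k) * pochhammer (\<beta> / 2 + of_nat k + 2) (m - k)"
    proof -
      have eqs: "- \<beta> / 2 - of_nat m - 1 = - (\<beta> / 2 + of_nat m + 1)"
        "\<beta> / 2 + of_nat m + 1 - of_nat (m - k) + 1 = \<beta> / 2 + of_nat k + 2"
        using that by (simp_all add: of_nat_diff)
      show ?thesis unfolding eqs(1) pochhammer_minus eqs(2) ..
    qed
    ultimately show ?thesis by (simp add: s_minus_coeff_def)
  qed
  have "s_minus \<beta> lam m = (\<Sum>k=0..m. smult (s_minus_coeff \<beta> lam m k) (R_poly k 0))"
    unfolding s_minus_def by (intro sum.cong refl) (simp only: coeff atLeastAtMost_iff)
  also have "\<dots> = (\<Sum>k=0..n. smult (s_minus_coeff \<beta> lam m k) (R_poly k 0))"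
    using assms by (intro sum.mono_neutral_left) (auto simp: s_minus_coeff_def)
  finally show ?thesis .
qed

text \<open>
  Let \<open>n = m - k\<close> and \<open>b = \<beta>/2\<close>. The prefactors on the right supply what the shorter Pochhammer
  symbols in \<open>\<lambda> - b\<close> lack, and \<open>m\<close> and \<open>m (m - 1)\<close> turn the smaller binomial coefficients into
  multiples \<open>n\<close> and \<open>n (n - 1)\<close> of \<open>m choose k\<close>. For \<open>n \<ge> 2\<close> every term therefore contains
  \<open>(m choose k) (\<lambda> - b + k + 1)\<^sub>n (b + k + 2)\<^sub>n\<^sub>-\<^sub>2\<close>, and the cofactors satisfy a polynomial identity.
  For \<open>n = 0\<close> and \<open>n = 1\<close> the index \<open>n - 2\<close> is negative; the last term then vanishes, and what
  remains has at most two terms, to be compared directly.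
\<close>

lemma D_one_eq_combination:
  assumes "k \<le> m" "m \<ge> 2"
  shows "D_one \<beta> lam m k =
           (lam - \<beta> + 2 * of_nat m) * s_minus_coeff \<beta> lam m k
         - 2 * of_nat m * (lam + 2 * of_nat m) * (lam - \<beta> / 2 + of_nat m)
             * s_minus_coeff \<beta> lam (m - 1) k
         + of_nat m * (of_nat m - 1) * (lam + \<beta> + 2 * of_nat m)
             * pochhammer (lam - \<beta> / 2 + of_nat m - 1) 2 * s_minus_coeff \<beta> lam (m - 2) k"
proof -
  define b where "b = \<beta> / 2"
  have \<beta>: "\<beta> = 2 * b" by (simp add: b_def)
  consider "k = m" | "m = Suc k" | i where "m = Suc (Suc (k + i))"
  proof -
    have "m = k \<or> m = Suc k \<or> m = Suc (Suc (k + (m - k - 2)))"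
      using assms(1) by arith
    then show ?thesis using that by blast
  qed
  then show ?thesis
  proof cases
    case 1
    have "m - 1 < k" "m - 2 < k" using 1 assms(2) by auto
    then have "s_minus_coeff \<beta> lam (m - 1) k = 0" "s_minus_coeff \<beta> lam (m - 2) k = 0"
      by (simp_all only: s_minus_coeff_def binomial_eq_0 of_nat_0 mult_zero_left)
    moreover have "s_minus_coeff \<beta> lam m k = 1" by (simp add: 1 s_minus_coeff_def)
    ultimately show ?thesis using 1 by (simp add: D_one_diag)
  next
    case 2
    have "m - 2 choose k = 0" using 2 assms(2) by (simp add: binomial_eq_0)
    then have vanish: "s_minus_coeff \<beta> lam (m - 2) k = 0"
      by (simp only: s_minus_coeff_def of_nat_0 mult_zero_left)
    show ?thesis
      unfolding vanish using 2 by (simp add: D_one_def poch_int_def s_minus_coeff_def \<beta> algebra_simps)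
  next
    case (3 i)
    \<comment> \<open>Here \<open>I + 2\<close> is the length \<open>m - k\<close> of the Pochhammer symbols.\<close>
    define M K I C :: complex where "M = of_nat m" and "K = of_nat k" and "I = of_nat i"
      and "C = of_nat (m choose k)"
    have M: "M = K + I + 2" by (simp add: M_def K_def I_def 3)
    have C1: "M * of_nat (m - 1 choose k) = (I + 2) * C"
      using arg_cong[OF binomial_absorb_comp[of m k, symmetric], of "of_nat :: nat \<Rightarrow> complex"]
      by (simp only: of_nat_mult flip: M_def C_def) (simp add: 3 I_def add.commute)
    have C2: "(M - 1) * of_nat (m - 2 choose k) = (I + 1) * of_nat (m - 1 choose k)"
      using arg_cong[OF binomial_absorb_comp[of "m - 1" k], of "of_nat :: nat \<Rightarrow> complex"]
      by (simp add: 3 I_def M_def Suc_diff_le algebra_simps)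
    have "M * (M - 1) * of_nat (m - 2 choose k) = M * ((M - 1) * of_nat (m - 2 choose k))"
      by (rule mult.assoc)
    also have "\<dots> = (I + 1) * (M * of_nat (m - 1 choose k))"
      unfolding C2 by (rule mult.left_commute)
    finally have C2': "M * (M - 1) * of_nat (m - 2 choose k) = (I + 1) * (I + 2) * C"
      unfolding C1 by (simp only: mult.assoc)
    define p where "p = pochhammer (lam - b + K + 1) i"
    define q where "q = pochhammer (b + K + 2) i"
    have p: "pochhammer (lam - b + K + 1) (m - k) = p * (lam - b + M - 1) * (lam - b + M)"
      "pochhammer (lam - b + K + 1) (m - 1 - k) = p * (lam - b + M - 1)"
      "pochhammer (lam - b + K + 1) (m - 2 - k) = p"
      by (simp_all add: p_def 3 pochhammer_Suc M I_def Suc_diff_le algebra_simps)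
    have q: "pochhammer (b + K + 2) (m - k) = q * (b + M) * (b + M + 1)"
      "pochhammer (b + K + 2) (m - 1 - k) = q * (b + M)"
      "pochhammer (b + K + 2) (m - 2 - k) = q"
      by (simp_all add: q_def 3 pochhammer_Suc M I_def Suc_diff_le algebra_simps)
    have q': "poch_int (b + K + 1) (int m - int k - 1) = (b + K + 1) * q"
      using pochhammer_rec[of "b + K + 1" i] by (simp add: poch_int_def 3 q_def nat_add_distrib add.assoc)
    have two: "pochhammer (lam - b + M - 1) 2 = (lam - b + M - 1) * (lam - b + M)"
      by (simp add: numeral_2_eq_2 pochhammer_Suc)
    \<comment> \<open>The factor common to all terms.\<close>
    define W where "W = C * p * (lam - b + M - 1) * (lam - b + M) * q"
    have "k \<noteq> m" using 3 by simp
    then have lhs: "D_one \<beta> lam m k = W * ((b + K + 1) * (K * (lam + 2 * b + 2 * M) + b * (lam - 2 * b - 2 * M)))"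
      by (simp add: D_one_def \<beta> p(1) q' W_def flip: C_def M_def K_def)
    have c2: "s_minus_coeff \<beta> lam m k = W * ((b + M) * (b + M + 1))"
      unfolding s_minus_coeff_def \<beta> using p(1) q(1) by (simp add: W_def flip: C_def K_def)
    have c1: "M * (lam - b + M) * s_minus_coeff \<beta> lam (m - 1) k = W * ((I + 2) * (b + M))"
    proof -
      have "M * (lam - b + M) * s_minus_coeff \<beta> lam (m - 1) k
          = (M * of_nat (m - 1 choose k)) * (lam - b + M) * (p * (lam - b + M - 1)) * (q * (b + M))"
        unfolding s_minus_coeff_def \<beta> using p(2) q(2) by (simp flip: K_def)
      then show ?thesis unfolding C1 W_def by (simp only: ac_simps)
    qed
    have c0: "M * (M - 1) * pochhammer (lam - b + M - 1) 2 * s_minus_coeff \<beta> lam (m - 2) k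
        = W * ((I + 1) * (I + 2))"
    proof -
      have "M * (M - 1) * pochhammer (lam - b + M - 1) 2 * s_minus_coeff \<beta> lam (m - 2) k
          = (M * (M - 1) * of_nat (m - 2 choose k)) * ((lam - b + M - 1) * (lam - b + M)) * p * q"
        unfolding s_minus_coeff_def \<beta> two using p(3) q(3) by (simp flip: K_def)
      then show ?thesis unfolding C2' W_def by (simp only: ac_simps)
    qed
    have bracket: "(b + K + 1) * (K * (lam + 2 * b + 2 * M) + b * (lam - 2 * b - 2 * M))
        = (lam - 2 * b + 2 * M) * ((b + M) * (b + M + 1))
          - 2 * (lam + 2 * M) * ((I + 2) * (b + M)) + (lam + 2 * b + 2 * M) * ((I + 1) * (I + 2))"
      unfolding M by algebra
    have "D_one \<beta> lam m k = (lam - 2 * b + 2 * M) * (W * ((b + M) * (b + M + 1)))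
        - 2 * (lam + 2 * M) * (W * ((I + 2) * (b + M))) + (lam + 2 * b + 2 * M) * (W * ((I + 1) * (I + 2)))"
      unfolding lhs bracket by (simp add: algebra_simps)
    also have "\<dots> = (lam - 2 * b + 2 * M) * s_minus_coeff \<beta> lam m k
        - 2 * M * (lam + 2 * M) * (lam - b + M) * s_minus_coeff \<beta> lam (m - 1) k
        + M * (M - 1) * (lam + 2 * b + 2 * M) * pochhammer (lam - b + M - 1) 2
            * s_minus_coeff \<beta> lam (m - 2) k"
      unfolding c2[symmetric] c1[symmetric] c0[symmetric] by (simp only: ac_simps)
    finally show ?thesis by (simp add: \<beta> M_def)
  qed
qed

text \<open>
  The product of \<open>(b + 1)\<^sub>k\<close> and \<open>(b + k + 1)\<^sub>m\<^sub>-\<^sub>k\<^sub>-\<^sub>1\<close> is \<open>(b + 1)\<^sub>m\<^sub>-\<^sub>1\<close>. For \<open>k = m\<close> the second symbol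
  is the reciprocal of \<open>b + m\<close>; there the bracket contains the factor \<open>b + m\<close>, so the formula
  holds also when \<open>b + m = 0\<close>.
\<close>

lemma D_one_times_pochhammer:
  assumes "k \<le> m" "m > 0"
  shows "D_one \<beta> lam m k * pochhammer (\<beta> / 2 + 1) k
           = pochhammer (\<beta> / 2 + 1) (m - 1)
               * (of_nat (m choose k) * pochhammer (lam - \<beta> / 2 + 1 + of_nat k) (m - k)
               * (of_nat k * (lam + \<beta> + 2 * of_nat m) + \<beta> / 2 * (lam - \<beta> - 2 * of_nat m)))"
proof (cases "k = m")
  case True
  obtain n where m: "m = Suc n" using assms(2) gr0_conv_Suc by blast
  have "of_nat m * (lam + \<beta> + 2 * of_nat m) + \<beta> / 2 * (lam - \<beta> - 2 * of_nat m)
      = (lam - \<beta> + 2 * of_nat m) * (\<beta> / 2 + of_nat m)"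
    by (simp add: field_simps)
  then show ?thesis
    by (simp add: True D_one_diag) (simp add: m pochhammer_Suc algebra_simps)
next
  case False
  have "poch_int (\<beta> / 2 + of_nat k + 1) (int m - int k - 1)
      = pochhammer (\<beta> / 2 + 1 + of_nat k) (m - 1 - k)"
    using poch_int_of_nat[of "\<beta> / 2 + of_nat k + 1" "m - 1 - k"] assms False
    by (simp add: of_nat_diff algebra_simps)
  moreover have "pochhammer (\<beta> / 2 + 1) (m - 1)
      = pochhammer (\<beta> / 2 + 1) k * pochhammer (\<beta> / 2 + 1 + of_nat k) (m - 1 - k)"
    using assms False by (intro pochhammer_product) simp
  ultimately show ?thesis
    using False by (simp add: D_one_def ac_simps)
qed

text \<open>
  The terms are \<open>T k\<close>, the summands of an alternating Chu-Vandermonde sum with \<open>a = - b\<close> and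
  \<open>c = \<lambda> - b + 1\<close>, times the bracket of \<open>D\<^sup>(\<^sup>1\<^sup>)\<^sub>k(m)\<close>. The bracket is linear in \<open>k\<close>, so the plain and
  the weighted sum suffice. Their combination simplifies by
  \<open>m (\<lambda> + 2b + 2m) + (\<lambda> - 2b - 2m) (\<lambda> + m) = \<lambda> (\<lambda> - 2b)\<close>.
\<close>

lemma sum_D_one_constants:
  assumes "m > 0"
  shows "(\<Sum>k\<le>m. D_one \<beta> lam m k * ((- 1) ^ k * pochhammer (\<beta> / 2 + 1) k * pochhammer (- \<beta> / 2) k))
           = pochhammer lam m * (lam - \<beta>) * pochhammer (\<beta> / 2) m"
proof -
  define b where "b = \<beta> / 2"
  have \<beta>: "\<beta> = 2 * b" by (simp add: b_def)
  obtain n where m: "m = Suc n" using assms gr0_conv_Suc by blast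
  define M :: complex where "M = of_nat m"
  define T where "T k = of_nat (m choose k) * (- 1) ^ k * pochhammer (- b) k
    * pochhammer (lam - b + 1 + of_nat k) (m - k)" for k
  have plain: "(\<Sum>k\<le>m. T k) = pochhammer (lam + 1) n * (lam + M)"
    unfolding T_def Chu_Vandermonde_alternating by (simp add: m M_def pochhammer_Suc ac_simps)
  have weighted: "(\<Sum>k\<le>m. of_nat k * T k) = M * b * pochhammer (lam + 1) n"
    unfolding T_def Chu_Vandermonde_alternating_weighted[OF assms] by (simp add: m M_def algebra_simps)
  have "(\<Sum>k\<le>m. D_one \<beta> lam m k * ((- 1) ^ k * pochhammer (\<beta> / 2 + 1) k * pochhammer (- \<beta> / 2) k))
      = (\<Sum>k\<le>m. pochhammer (b + 1) n
          * ((lam + 2 * b + 2 * M) * (of_nat k * T k) + b * (lam - 2 * b - 2 * M) * T k))"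
  proof (rule sum.cong[OF refl])
    fix k assume "k \<in> {..m}"
    then have D: "D_one \<beta> lam m k * pochhammer (b + 1) k = pochhammer (b + 1) n
        * (of_nat (m choose k) * pochhammer (lam - b + 1 + of_nat k) (m - k)
          * (of_nat k * (lam + 2 * b + 2 * M) + b * (lam - 2 * b - 2 * M)))"
      using D_one_times_pochhammer[OF _ assms, of k \<beta> lam] by (simp add: \<beta> M_def m)
    have "D_one \<beta> lam m k * ((- 1) ^ k * pochhammer (\<beta> / 2 + 1) k * pochhammer (- \<beta> / 2) k)
        = (D_one \<beta> lam m k * pochhammer (b + 1) k) * ((- 1) ^ k * pochhammer (- b) k)"
      by (simp add: \<beta>)
    also have "\<dots> = pochhammer (b + 1) n
          * ((lam + 2 * b + 2 * M) * (of_nat k * T k) + b * (lam - 2 * b - 2 * M) * T k)"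
      unfolding D T_def by (simp only: distrib_left distrib_right ac_simps)
    finally show "D_one \<beta> lam m k * ((- 1) ^ k * pochhammer (\<beta> / 2 + 1) k * pochhammer (- \<beta> / 2) k)
        = pochhammer (b + 1) n
          * ((lam + 2 * b + 2 * M) * (of_nat k * T k) + b * (lam - 2 * b - 2 * M) * T k)" .
  qed
  also have "\<dots> = pochhammer (b + 1) n
      * ((lam + 2 * b + 2 * M) * (M * b * pochhammer (lam + 1) n)
        + b * (lam - 2 * b - 2 * M) * (pochhammer (lam + 1) n * (lam + M)))"
    by (simp only: sum_distrib_left[symmetric] sum.distrib plain weighted)
  also have "\<dots> = (lam * pochhammer (lam + 1) n) * (lam - 2 * b) * (b * pochhammer (b + 1) n)"
    by algebra
  finally show ?thesis by (simp add: m \<beta> pochhammer_rec)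
qed

section \<open>The expansion of $s^{(1)}_m$\<close>

lemma smult_sum_distrib: "smult a (\<Sum>k\<in>A. f k) = (\<Sum>k\<in>A. smult a (f k))"
  by (induction A rule: infinite_finite_induct) (simp_all add: smult_add_right)

lemma s_minus_zero: "s_minus \<beta> lam 0 = 1"
  by (simp add: s_minus_def R_poly_def)

theorem theorem2p6:
  fixes \<beta> lam :: complex and m :: nat
  assumes "m \<ge> 2"
  shows "s_one \<beta> lam m =
           smult (lam - \<beta> + 2 * of_nat m) (s_minus \<beta> lam m)
         - smult (2 * of_nat m * (lam + 2 * of_nat m) * (lam - \<beta> / 2 + of_nat m))
             (s_minus \<beta> lam (m - 1))
         + smult (of_nat m * (of_nat m - 1) * (lam + \<beta> + 2 * of_nat m)
                    * pochhammer (lam - \<beta> / 2 + of_nat m - 1) 2)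
             (s_minus \<beta> lam (m - 2))
         - smult (pochhammer lam m * (lam - \<beta>) * pochhammer (\<beta> / 2) m)
             (s_minus \<beta> lam 0)
         \<and> s_minus \<beta> lam 0 = 1"
proof
  have "s_one \<beta> lam m = (\<Sum>k=0..m. smult (D_one \<beta> lam m k) (R_poly k 0))
      - [:\<Sum>k\<le>m. D_one \<beta> lam m k * ((- 1) ^ k * pochhammer (\<beta> / 2 + 1) k * pochhammer (- \<beta> / 2) k):]"
    by (simp add: s_one_def R_one_eq smult_diff_right sum_subtractf sum_to_poly atLeast0AtMost)
  also have "\<dots> = (\<Sum>k=0..m. smult (D_one \<beta> lam m k) (R_poly k 0))
      - [:pochhammer lam m * (lam - \<beta>) * pochhammer (\<beta> / 2) m:]"
    using assms by (subst sum_D_one_constants) auto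
  also have "(\<Sum>k=0..m. smult (D_one \<beta> lam m k) (R_poly k 0)) =
           smult (lam - \<beta> + 2 * of_nat m) (s_minus \<beta> lam m)
         - smult (2 * of_nat m * (lam + 2 * of_nat m) * (lam - \<beta> / 2 + of_nat m))
             (s_minus \<beta> lam (m - 1))
         + smult (of_nat m * (of_nat m - 1) * (lam + \<beta> + 2 * of_nat m)
                    * pochhammer (lam - \<beta> / 2 + of_nat m - 1) 2)
             (s_minus \<beta> lam (m - 2))"
    unfolding s_minus_eq[OF order.refl[of m]] s_minus_eq[OF diff_le_self[of m 1]]
      s_minus_eq[OF diff_le_self[of m 2]] smult_sum_distrib sum_subtractf[symmetric] sum.distrib[symmetric]
    using assms by (intro sum.cong refl)
      (simp add: D_one_eq_combination smult_add_left smult_diff_left)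
  finally show "s_one \<beta> lam m =
           smult (lam - \<beta> + 2 * of_nat m) (s_minus \<beta> lam m)
         - smult (2 * of_nat m * (lam + 2 * of_nat m) * (lam - \<beta> / 2 + of_nat m))
             (s_minus \<beta> lam (m - 1))
         + smult (of_nat m * (of_nat m - 1) * (lam + \<beta> + 2 * of_nat m)
                    * pochhammer (lam - \<beta> / 2 + of_nat m - 1) 2)
             (s_minus \<beta> lam (m - 2))
         - smult (pochhammer lam m * (lam - \<beta>) * pochhammer (\<beta> / 2) m)
             (s_minus \<beta> lam 0)"
    by (simp add: s_minus_zero one_pCons)
qed (rule s_minus_zero)

end
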